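(* Let $f$, $h$, $A$, $b$ be as in the context, and suppose that: (1) there exists $(x,\lambda)\in \mathrm{dom}(h)\times\mathbb{R}^m$ with $0\in\nabla f(x)+\partial h(x)+A^\top\lambda$ and $Ax-b=0$; (2) $\|\nabla f(x)-\nabla f(x')\|\le L_f\|x-x'\|$ for all $x,x'\in\mathrm{dom}(h)$; (3) $\mathrm{dom}(h)$ is compact. Let $\{(x_k,z_k,\lambda_k,\mu_k)\}$ be the sequence generated by Algorithm 1 (described in the context). Then the multiplier sequences $\{\mu_k\}$ and $\{\lambda_k\}$ are bounded.
   Context: Setting: $f:\mathbb{R}^n\to\mathbb{R}$ is continuously differentiable (possibly nonconvex) with $L_f$-Lipschitz gradient, $L_f>0$; $h:\mathbb{R}^n\to\mathbb{R}\cup\{+\infty\}$ is a proper closed convex (not necessarily smooth) function with $\mathrm{dom}(h)=\{x:h(x)<+\infty\}$ and convex subdifferential $\partial h$; $A:\mathbb{R}^n\to\mathbb{R}^m$ is linear with largest singular value $\sigma_{\max}$; $b\in\mathbb{R}^m$; $\|\cdot\|$ is the Euclidean norm. The problem is $\min_{x}\, f(x)+h(x)$ s.t. $Ax=b$. Algorithm 1. Parameters: a fixed (large) constant $\alpha>1$, $\beta\in(0,1)$, $\rho:=\frac{\alpha}{1+\alpha\beta}$, $r\in(0.9,1)$, $0<\eta<\frac{1}{L_f+(2+\frac{1}{1+\alpha\beta})\rho\sigma_{\max}^2}$. Initialization: $(x_0,z_0,\lambda_0,\mu_0)\in\mathbb{R}^n\times\mathbb{R}^m\times\mathbb{R}^m\times\mathbb{R}^m$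 and $\delta_0\in(0,1]$. For $k=0,1,2,\dots$: $$x_{k+1}=\operatorname*{argmin}_{x\in\mathbb{R}^n}\Big\{\langle\nabla f(x_k)+A^\top\lambda_k,\,x-x_k\rangle+\tfrac{1}{2\eta}\|x-x_k\|^2+h(x)\Big\},$$ $$\mu_{k+1}=\mu_k+\tau_k(\lambda_k-\mu_k),\quad \tau_k=\frac{\delta_k}{\|\lambda_k-\mu_k\|^2+1},$$ $$\lambda_{k+1}=\mu_{k+1}+\rho(Ax_{k+1}-b),\qquad z_{k+1}=\frac{\lambda_{k+1}-\mu_{k+1}}{\alpha},\qquad \delta_{k+1}=r\,\delta_k.$$ *)

theory Defs
  imports "HOL-Analysis.Analysis"
begin

text \<open>Extended-real-valued functions on a Euclidean space. A proper function never takes the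
  value minus infinity, so \<^typ>\<open>ereal\<close> is the codomain of the reals with plus infinity added.\<close>

definition eff_dom :: "('a \<Rightarrow> ereal) \<Rightarrow> 'a set" where
  "eff_dom h = {x. h x < \<infinity>}"

definition epi :: "('a \<Rightarrow> ereal) \<Rightarrow> ('a \<times> real) set" where
  "epi h = {(x, t). h x \<le> ereal t}"

definition proper_fun :: "('a \<Rightarrow> ereal) \<Rightarrow> bool" where
  "proper_fun h \<longleftrightarrow> (\<forall>x. h x \<noteq> -\<infinity>) \<and> eff_dom h \<noteq> {}"

definition closed_fun :: "('a::euclidean_space \<Rightarrow> ereal) \<Rightarrow> bool" where
  "closed_fun h \<longleftrightarrow> closed (epi h)"

definition convex_fun :: "('a::euclidean_space \<Rightarrow> ereal) \<Rightarrow> bool" where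
  "convex_fun h \<longleftrightarrow> convex (epi h)"

text \<open>For proper \<open>h\<close> this is empty outside the effective domain.\<close>

definition subdifferential :: "('a::euclidean_space \<Rightarrow> ereal) \<Rightarrow> 'a \<Rightarrow> 'a set" where
  "subdifferential h x = {g. \<forall>y. h y \<ge> h x + ereal (g \<bullet> (y - x))}"

text \<open>The singular values are the nonnegative square roots of the eigenvalues of the Gram matrix.
  That matrix is square, symmetric and of positive size, so the set is finite and nonempty. If there
  are more columns than rows, the set contains additional zeros, which do not affect its maximum.\<close>

definition singular_values :: "real^'n^'m \<Rightarrow> real set" where
  "singular_values A =
     {s. s \<ge> 0 \<and> (\<exists>v. v \<noteq> 0 \<and> (transpose A ** A) *v v = s\<^sup>2 *\<^sub>R v)}"

definition sigma_max :: "real^'n^'m \<Rightarrow> real" where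
  "sigma_max A = Max (singular_values A)"

definition rho :: "real \<Rightarrow> real \<Rightarrow> real" where
  "rho \<alpha> \<beta> = \<alpha> / (1 + \<alpha> * \<beta>)"

definition admissible_params ::
    "real \<Rightarrow> real^'n^'m \<Rightarrow> real \<Rightarrow> real \<Rightarrow> real \<Rightarrow> real \<Rightarrow> real \<Rightarrow> bool" where
  "admissible_params L A \<alpha> \<beta> r \<eta> \<delta>\<^sub>0 \<longleftrightarrow>
     \<alpha> > 1 \<and> 0 < \<beta> \<and> \<beta> < 1 \<and> 0.9 < r \<and> r < 1 \<and>
     0 < \<eta> \<and> \<eta> < 1 / (L + (2 + 1 / (1 + \<alpha> * \<beta>)) * rho \<alpha> \<beta> * (sigma_max A)\<^sup>2) \<and>
     0 < \<delta>\<^sub>0 \<and> \<delta>\<^sub>0 \<le> 1"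

text \<open>\<open>G\<close> is the gradient of the smooth part. The values of \<open>x\<close>, \<open>z\<close>, \<open>lam\<close> and \<open>mu\<close> at index
  zero are arbitrary. The objective of the \<open>x\<close>-step is strongly convex, so being a minimizer is the
  same as being the unique one.\<close>

definition algorithm_sequence ::
    "(real^'n \<Rightarrow> real^'n) \<Rightarrow> (real^'n \<Rightarrow> ereal) \<Rightarrow> real^'n^'m \<Rightarrow> real^'m \<Rightarrow>
     real \<Rightarrow> real \<Rightarrow> real \<Rightarrow> real \<Rightarrow> real \<Rightarrow>
     (nat \<Rightarrow> real^'n) \<Rightarrow> (nat \<Rightarrow> real^'m) \<Rightarrow> (nat \<Rightarrow> real^'m) \<Rightarrow> (nat \<Rightarrow> real^'m) \<Rightarrow> bool" where
  "algorithm_sequence G h A b \<alpha> \<beta> r \<eta> \<delta>\<^sub>0 x z lam mu \<longleftrightarrow>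
     (\<exists>\<delta> :: nat \<Rightarrow> real. \<exists>\<tau> :: nat \<Rightarrow> real. \<delta> 0 = \<delta>\<^sub>0 \<and> (\<forall>k.
        is_arg_min
          (\<lambda>y. ereal ((G (x k) + transpose A *v lam k) \<bullet> (y - x k)
                      + 1 / (2 * \<eta>) * (norm (y - x k))\<^sup>2) + h y)
          (\<lambda>_. True) (x (Suc k)) \<and>
        \<tau> k = \<delta> k / ((norm (lam k - mu k))\<^sup>2 + 1) \<and>
        mu (Suc k) = mu k + \<tau> k *\<^sub>R (lam k - mu k) \<and>
        lam (Suc k) = mu (Suc k) + rho \<alpha> \<beta> *\<^sub>R (A *v x (Suc k) - b) \<and>
        z (Suc k) = (1 / \<alpha>) *\<^sub>R (lam (Suc k) - mu (Suc k)) \<and>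
        \<delta> (Suc k) = r * \<delta> k))"

end

theory Submission
  imports Defs
begin

text \<open>The weight \<tau>_k is normalised so that the step from \<open>mu k\<close> to
  \<open>mu (Suc k)\<close> has length at most \<delta>_k, however far \<open>lam k\<close> is from
  \<open>mu k\<close> (\<open>norm_scaled_div_square_le\<close>). As \<delta>_k decays
  geometrically, the steps are summable and \<open>mu\<close> stays bounded
  (\<open>bounded_range_geometric_steps\<close>). From index 1 on, \<open>lam\<close> differs from
  \<open>mu\<close> by a fixed multiple of the residual Ax - b. Each such x minimises an objective
  containing h, hence lies in the compact effective domain
  (\<open>arg_min_ereal_add_in_eff_dom\<close>), so the residuals are bounded and so is
  \<open>lam\<close>.\<close>

lemma arg_min_ereal_add_in_eff_dom:
  assumes "is_arg_min (\<lambda>y. ereal (q y) + h y) (\<lambda>_. True) p" and "eff_dom h \<noteq> {}"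
  shows "p \<in> eff_dom h"
proof (rule ccontr)
  assume "p \<notin> eff_dom h"
  then have "h p = \<infinity>"
    by (simp add: eff_dom_def)
  moreover obtain v where "h v < \<infinity>"
    using assms(2) by (auto simp: eff_dom_def)
  \<comment> \<open>Since \<open>q\<close> is real-valued, the sum is infinite at \<open>p\<close>
    but not at \<open>v\<close>.\<close>
  ultimately have "ereal (q v) + h v < ereal (q p) + h p"
    by simp
  then show False
    using assms(1) by (auto simp: is_arg_min_def)
qed

text \<open>The denominator dominates \<open>norm v\<close>, because 2t \<le> t^2 + 1 for every real
  t; the bound is therefore uniform in \<open>v\<close>.\<close>

lemma norm_scaled_div_square_le:
  fixes v :: "'a::real_normed_vector"
  assumes "0 \<le> d"
  shows "norm ((d / ((norm v)\<^sup>2 + 1)) *\<^sub>R v) \<le> d"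
proof -
  have "0 \<le> (norm v - 1)\<^sup>2"
    by simp
  then have "2 * norm v \<le> (norm v)\<^sup>2 + 1"
    by (simp add: power2_diff)
  then have "norm v \<le> (norm v)\<^sup>2 + 1"
    using norm_ge_zero[of v] by linarith
  moreover have pos: "0 < (norm v)\<^sup>2 + 1"
    by (simp add: add_nonneg_pos)
  ultimately have "d * (norm v / ((norm v)\<^sup>2 + 1)) \<le> d * 1"
    using assms by (intro mult_left_mono) auto
  then show ?thesis
    using assms pos by simp
qed

text \<open>The total path length is at most the geometric series with sum d_0 / (1 - r).\<close>

lemma bounded_range_geometric_steps:
  fixes u :: "nat \<Rightarrow> 'a::real_normed_vector"
  assumes step: "\<And>k. norm (u (Suc k) - u k) \<le> d k"
    and d_Suc: "\<And>k. d (Suc k) = r * d k"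
    and "0 \<le> d 0" "0 \<le> r" "r < 1"
  shows "bounded (range u)"
proof -
  have d_nonneg: "0 \<le> d k" for k
    by (induction k) (use assms in auto)
  \<comment> \<open>The term \<open>d k / (1 - r)\<close> is the tail of the series from k on, a
    budget for all remaining steps. A step raises the norm by at most \<open>d k\<close>, exactly
    what the budget loses, so the sum never increases.\<close>
  have "norm (u k) + d k / (1 - r) \<le> norm (u 0) + d 0 / (1 - r)" for k
  proof (induction k)
    case (Suc k)
    have "norm (u (Suc k)) \<le> norm (u k) + d k"
      using step[of k] norm_triangle_sub[of "u (Suc k)" "u k"] by linarith
    moreover have "d k + d (Suc k) / (1 - r) = d k / (1 - r)"
      using \<open>r < 1\<close> by (simp add: d_Suc field_simps)
    ultimately show ?case
      using Suc by linarith
  qed simp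
  moreover have "0 \<le> d k / (1 - r)" for k
    using d_nonneg \<open>r < 1\<close> by simp
  ultimately have "norm (u k) \<le> norm (u 0) + d 0 / (1 - r)" for k
    by (smt (verit))
  then show ?thesis
    by (auto simp: bounded_iff)
qed

theorem lemma1:
  fixes f :: "real^'n \<Rightarrow> real" and G :: "real^'n \<Rightarrow> real^'n"
    and h :: "real^'n \<Rightarrow> ereal"
    and A :: "real^'n^'m" and b :: "real^'m"
    and L \<alpha> \<beta> r \<eta> \<delta>\<^sub>0 :: real
    and x :: "nat \<Rightarrow> real^'n" and z lam mu :: "nat \<Rightarrow> real^'m"
  assumes grad_f: "\<And>u. GDERIV f u :> G u"
    and cont_grad_f: "continuous_on UNIV G"
    and L_pos: "L > 0"
    and h_proper: "proper_fun h"
    and h_closed: "closed_fun h"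
    and h_convex: "convex_fun h"
    and KKT: "\<exists>u \<in> eff_dom h. \<exists>l :: real^'m.
                0 \<in> (\<lambda>g. G u + g + transpose A *v l) ` subdifferential h u \<and> A *v u - b = 0"
    and Lipschitz: "\<And>u u'. u \<in> eff_dom h \<Longrightarrow> u' \<in> eff_dom h \<Longrightarrow>
                      norm (G u - G u') \<le> L * norm (u - u')"
    and dom_compact: "compact (eff_dom h)"
    and params: "admissible_params L A \<alpha> \<beta> r \<eta> \<delta>\<^sub>0"
    and alg: "algorithm_sequence G h A b \<alpha> \<beta> r \<eta> \<delta>\<^sub>0 x z lam mu"
  shows "bounded (range mu) \<and> bounded (range lam)"
proof -
  from alg obtain \<delta> \<tau> where \<delta>_0: "\<delta> 0 = \<delta>\<^sub>0"
    and x_step: "\<And>k. is_arg_min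
          (\<lambda>y. ereal ((G (x k) + transpose A *v lam k) \<bullet> (y - x k)
                      + 1 / (2 * \<eta>) * (norm (y - x k))\<^sup>2) + h y)
          (\<lambda>_. True) (x (Suc k))"
    and \<tau>: "\<And>k. \<tau> k = \<delta> k / ((norm (lam k - mu k))\<^sup>2 + 1)"
    and mu_step: "\<And>k. mu (Suc k) = mu k + \<tau> k *\<^sub>R (lam k - mu k)"
    and lam_step: "\<And>k. lam (Suc k) = mu (Suc k) + rho \<alpha> \<beta> *\<^sub>R (A *v x (Suc k) - b)"
    and \<delta>_Suc: "\<And>k. \<delta> (Suc k) = r * \<delta> k"
    unfolding algorithm_sequence_def by blast
  have r: "0 \<le> r" "r < 1" and "0 \<le> \<delta> 0"
    using params \<delta>_0 by (auto simp: admissible_params_def)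
  have \<delta>_nonneg: "0 \<le> \<delta> k" for k
    by (induction k) (use r \<open>0 \<le> \<delta> 0\<close> in \<open>auto simp: \<delta>_Suc\<close>)
  have "norm (mu (Suc k) - mu k) \<le> \<delta> k" for k
    using norm_scaled_div_square_le[OF \<delta>_nonneg] by (simp add: mu_step \<tau>)
  then have bounded_mu: "bounded (range mu)"
    using \<delta>_Suc \<open>0 \<le> \<delta> 0\<close> r by (rule bounded_range_geometric_steps)
  \<comment> \<open>The starting point \<open>x 0\<close> is arbitrary and may lie outside the
    domain, so the bounds on x and \<open>lam\<close> begin at index 1.\<close>
  have "x (Suc k) \<in> eff_dom h" for k
    using arg_min_ereal_add_in_eff_dom[OF x_step] h_proper by (simp add: proper_fun_def)
  then have "bounded (range (\<lambda>k. x (Suc k)))"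
    using compact_imp_bounded[OF dom_compact] by (auto elim!: bounded_subset)
  then have "bounded (range (\<lambda>k. A *v x (Suc k)))"
    using bounded_linear_image[OF _ matrix_vector_mul_bounded_linear[of A]]
    by (fastforce simp: image_image)
  then have "bounded (range (\<lambda>k. rho \<alpha> \<beta> *\<^sub>R (A *v x (Suc k) - b)))"
    using bounded_scaling[OF bounded_translation_minus] by (fastforce simp: image_image)
  moreover have "bounded (range (\<lambda>k. mu (Suc k)))"
    using bounded_mu by (rule bounded_subset) auto
  ultimately have "bounded (range (\<lambda>k. lam (Suc k)))"
    unfolding lam_step by (intro bounded_plus_comp)
  \<comment> \<open>The arbitrary initial multiplier \<open>lam 0\<close> adds only one point to the
    range.\<close>
  then have "bounded (insert (lam 0) (range (\<lambda>k. lam (Suc k))))"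
    by simp
  moreover have "range lam \<subseteq> insert (lam 0) (range (\<lambda>k. lam (Suc k)))"
    by (auto simp: image_iff) (metis not0_implies_Suc)
  ultimately have "bounded (range lam)"
    by (rule bounded_subset)
  with bounded_mu show ?thesis
    by blast
qed

end
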